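(* Let $X$ be a real Hilbert space, let $\alpha\in\mathbb{R}\smallsetminus\{0\}$, $\beta>0$, and set $S:=\{(\mathbf{x},\mathbf{y},\gamma)\in X\times X\times\mathbb{R} : \langle\mathbf{x},\mathbf{y}\rangle=\alpha\gamma\}$. Suppose $\mathbf{z}\in X\smallsetminus\{0\}$, set $\zeta:=\|\mathbf{z}\|>0$, let $\gamma\in\mathbb{R}$, and assume that $$\alpha(\gamma-\alpha/\beta^2)<-\zeta^2/4.$$ Set $$p:=-\frac{(\alpha+\beta^2\gamma)^2}{3\alpha^2},\qquad q:=\frac{2(\alpha+\beta^2\gamma)^3}{27\alpha^3}+\frac{\beta^2\zeta^2}{\alpha^2},$$ $$\Delta:=(p/3)^3+(q/2)^2=\frac{\beta^2\zeta^2}{\alpha^2}\Big(\frac{\beta^2\zeta^2}{4\alpha^2}+\frac{(\alpha+\beta^2\gamma)^3}{27\alpha^3}\Big).$$ If $\Delta\geq0$, then set $$x:=\frac{2\alpha-\beta^2\gamma}{3\alpha}+\sqrt[3]{\frac{-q}{2}+\sqrt{\Delta}}+\sqrt[3]{\frac{-q}{2}-\sqrt{\Delta}};$$ and if $\Delta<0$, then set $$x:=\frac{2\alpha-\beta^2\gamma}{3\alpha}+\delta\,\frac{2(\alpha+\beta^2\gamma)}{3\alpha}\cos\bigg(\frac13\Big((3+\delta)\pi+\arccos\frac{-q/2}{(-p/3)^{3/2}}\Big)\bigg),$$ where $\delta:=\operatorname{sign}(\alpha^2+\alpha\beta^2\gamma)\in\{-1,0,1\}$. Then $-1<x<1$ and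 $$P_S(\mathbf{z},-\mathbf{z},\gamma)=\Big(\frac{\mathbf{z}}{1-x},\frac{-\mathbf{z}}{1-x},\gamma+\frac{\alpha x}{\beta^2}\Big).$$
   Context: The space $X\times X\times\mathbb{R}$ carries the Hilbert product norm $\|(\mathbf{x},\mathbf{y},\gamma)\|:=\sqrt{\|\mathbf{x}\|^2+\|\mathbf{y}\|^2+\beta^2\gamma^2}$, and $P_S$ is the projection onto the (nonconvex) set $S$ with respect to this norm: $P_S(w)$ is the set of nearest points of $S$ to $w$; writing $P_S(w)=s$ means that $s$ is the unique nearest point. For real $t$, $\sqrt[3]{t}$ denotes the unique real cube root of $t$ (also for negative $t$). $\arccos$ takes values in $[0,\pi]$; $\operatorname{sign}(0)=0$. *)

theory Defs
  imports "HOL-Analysis.Analysis"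
begin

definition bilinear_graph :: "real \<Rightarrow> ('a::real_inner \<times> 'a \<times> real) set"
  where "bilinear_graph \<alpha> = {(x, y, \<gamma>). x \<bullet> y = \<alpha> * \<gamma>}"

text \<open>The library norm on the product type is the unweighted one, which agrees with
  \<open>weighted_norm \<beta>\<close> only for \<open>\<beta>\<^sup>2 = 1\<close>.\<close>

definition weighted_norm :: "real \<Rightarrow> 'a::real_normed_vector \<times> 'a \<times> real \<Rightarrow> real"
  where "weighted_norm \<beta> = (\<lambda>(x, y, \<gamma>). sqrt ((norm x)\<^sup>2 + (norm y)\<^sup>2 + \<beta>\<^sup>2 * \<gamma>\<^sup>2))"

text \<open>The projection is set-valued: it may be empty or contain several points, and
  \<open>P\<^sub>S(w) = s\<close> is expressed as \<open>nearest_points \<beta> S w = {s}\<close>.\<close>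

definition nearest_points ::
  "real \<Rightarrow> ('a::real_normed_vector \<times> 'a \<times> real) set \<Rightarrow> 'a \<times> 'a \<times> real \<Rightarrow> ('a \<times> 'a \<times> real) set"
  where "nearest_points \<beta> S w =
    {s \<in> S. \<forall>t\<in>S. weighted_norm \<beta> (w - s) \<le> weighted_norm \<beta> (w - t)}"

end

theory Submission
  imports Defs
begin

text \<open>
  Introduce a multiplier \<open>x\<close> for the constraint \<open>u \<bullet> v = \<alpha> * g\<close>. Stationarity of the Lagrangian at
  \<open>(z, - z, \<gamma>)\<close> gives the point \<open>(z / (1 - x), - z / (1 - x), \<gamma> + \<alpha> * x / \<beta>\<^sup>2)\<close>. In the
  coordinates \<open>u + v\<close>, \<open>u - v\<close>, \<open>g\<close> the Lagrangian is a diagonal quadratic form whose weights are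
  positive multiples of \<open>1 + x\<close>, \<open>1 - x\<close> and \<open>\<beta>\<^sup>2\<close>. For \<open>-1 < x < 1\<close> it is therefore strictly
  convex, and since it agrees with the squared distance on the graph, a stationary point that lies on
  the graph is the unique nearest point, although the graph is not convex
  (\<open>nearest_points_bilinear_graph_antidiagonal\<close>).

  What remains is to choose \<open>x\<close> so that the stationary point lies on the graph. With
  \<open>k = \<beta>\<^sup>2 * \<gamma> / \<alpha>\<close> and \<open>c = \<beta>\<^sup>2 * \<zeta>\<^sup>2 / \<alpha>\<^sup>2 > 0\<close> this is the cubic equation
  \<open>(x + k) * (1 - x)\<^sup>2 + c = 0\<close>. The hypothesis on \<open>\<gamma>\<close> says that its left side is negative at \<open>-1\<close>,
  which forces every root below \<open>1\<close> to exceed \<open>-1\<close> (\<open>multiplier_gt_minus_one\<close>). Put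
  \<open>m = (1 + k) / 3\<close> and \<open>x = 1 - m + y\<close>: the equation becomes \<open>y\<^sup>3 - 3 * m\<^sup>2 * y + (2 * m\<^sup>3 + c) = 0\<close>,
  and \<open>x < 1\<close> becomes \<open>y < m\<close>. Depending on the sign of the discriminant, a root is given by
  Cardano's formula or by Viete's cosine formula; in both cases the point is to check that the root
  written down is the one below \<open>m\<close> (\<open>cardano_root_less\<close>, \<open>viete_root_less\<close>).
\<close>

section \<open>The projection in terms of a multiplier\<close>

text \<open>
  Adding \<open>2 * x * (u \<bullet> v - \<alpha> * g)\<close> to the left side gives the Lagrangian, and the right side arises
  by completing squares around its stationary point \<open>(t, - t, h)\<close>. Nothing else is left over because
  the added term vanishes both at \<open>(u, v, g)\<close> and at \<open>(t, - t, h)\<close>.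
\<close>
lemma squared_distance_bilinear_graph:
  fixes t u v :: "'a::real_inner"
  assumes "\<beta> \<noteq> 0"
    and uv: "u \<bullet> v = \<alpha> * g"
    and t: "t \<bullet> (- t) = \<alpha> * h"
    and \<gamma>: "\<gamma> = h - \<alpha> * x / \<beta>\<^sup>2"
  defines "z \<equiv> (1 - x) *\<^sub>R t"
  shows "(norm (z - u))\<^sup>2 + (norm (- z - v))\<^sup>2 + \<beta>\<^sup>2 * (\<gamma> - g)\<^sup>2 =
    (norm (z - t))\<^sup>2 + (norm (- z + t))\<^sup>2 + \<beta>\<^sup>2 * (\<gamma> - h)\<^sup>2
      + ((1 + x) / 2 * (norm (u + v))\<^sup>2
         + (1 - x) / 2 * (norm (u - v - 2 *\<^sub>R t))\<^sup>2 + \<beta>\<^sup>2 * (g - h)\<^sup>2)"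
proof -
  have "\<beta>\<^sup>2 * (\<gamma> - g)\<^sup>2 = \<beta>\<^sup>2 * (\<gamma> - h)\<^sup>2 + \<beta>\<^sup>2 * (g - h)\<^sup>2 + 2 * x * (\<alpha> * g - \<alpha> * h)"
    unfolding \<gamma> using \<open>\<beta> \<noteq> 0\<close> by (simp add: field_simps power2_eq_square)
  moreover have "(norm (z - u))\<^sup>2 + (norm (- z - v))\<^sup>2 + 2 * x * (u \<bullet> v + t \<bullet> t) =
    (norm (z - t))\<^sup>2 + (norm (- z + t))\<^sup>2
      + ((1 + x) / 2 * (norm (u + v))\<^sup>2 + (1 - x) / 2 * (norm (u - v - 2 *\<^sub>R t))\<^sup>2)"
    unfolding z_def power2_norm_eq_inner
    by (simp add: inner_diff inner_add inner_commute field_simps)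
  moreover have "t \<bullet> t = - (\<alpha> * h)"
    using t by simp
  ultimately show ?thesis
    unfolding uv by (simp add: algebra_simps)
qed

lemma nearest_points_bilinear_graph_antidiagonal:
  fixes z :: "'a::real_inner"
  assumes "\<beta> \<noteq> 0" and x: "-1 < x" "x < 1"
    and mult: "\<alpha> * (\<gamma> + \<alpha> * x / \<beta>\<^sup>2) + (norm z)\<^sup>2 / (1 - x)\<^sup>2 = 0"
  shows "nearest_points \<beta> (bilinear_graph \<alpha>) (z, - z, \<gamma>)
    = {((1 / (1 - x)) *\<^sub>R z, (1 / (1 - x)) *\<^sub>R (- z), \<gamma> + \<alpha> * x / \<beta>\<^sup>2)}"
proof -
  define t where "t = (1 / (1 - x)) *\<^sub>R z"
  define h where "h = \<gamma> + \<alpha> * x / \<beta>\<^sup>2"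
  define E where "E = (\<lambda>(u, v, g). (1 + x) / 2 * (norm (u + v))\<^sup>2
         + (1 - x) / 2 * (norm (u - v - 2 *\<^sub>R t))\<^sup>2 + \<beta>\<^sup>2 * (g - h)\<^sup>2)"
  have z: "z = (1 - x) *\<^sub>R t"
    using x by (simp add: t_def)
  have t: "t \<bullet> (- t) = \<alpha> * h"
    using mult
    by (simp add: t_def h_def power2_norm_eq_inner[symmetric] power2_eq_square[of "1 - x"]
        del: inner_minus_right) (simp add: power2_norm_eq_inner)
  have graph: "(t, - t, h) \<in> bilinear_graph \<alpha>"
    using t by (simp add: bilinear_graph_def)
  define d where "d = weighted_norm \<beta> ((z, - z, \<gamma>) - (t, - t, h))"
  have "d \<ge> 0"
    by (simp add: d_def weighted_norm_def)
  have dist: "weighted_norm \<beta> ((z, - z, \<gamma>) - w) =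
      sqrt (d\<^sup>2 + E w)"
    if "w \<in> bilinear_graph \<alpha>" for w
  proof -
    obtain u v g where w: "w = (u, v, g)"
      by (cases w)
    have "u \<bullet> v = \<alpha> * g"
      using that by (simp add: w bilinear_graph_def)
    from squared_distance_bilinear_graph[OF \<open>\<beta> \<noteq> 0\<close> this t, of \<gamma> x] show ?thesis
      by (simp add: w d_def weighted_norm_def E_def z[symmetric] h_def)
  qed
  have E_nonneg: "E w \<ge> 0" for w
    using x by (cases w) (simp add: E_def)
  have E_zero: "w = (t, - t, h)" if "E w \<le> 0" for w
  proof -
    obtain u v g where w: "w = (u, v, g)"
      by (cases w)
    have nn: "(1 + x) / 2 * (norm (u + v))\<^sup>2 \<ge> 0"
      "(1 - x) / 2 * (norm (u - v - 2 *\<^sub>R t))\<^sup>2 \<ge> 0" "\<beta>\<^sup>2 * (g - h)\<^sup>2 \<ge> 0"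
      using x by auto
    have "(1 + x) / 2 * (norm (u + v))\<^sup>2 = 0"
      "(1 - x) / 2 * (norm (u - v - 2 *\<^sub>R t))\<^sup>2 = 0" "\<beta>\<^sup>2 * (g - h)\<^sup>2 = 0"
      using that nn unfolding w E_def prod.case by linarith+
    then have "u + v = 0" and uvt: "u - v - 2 *\<^sub>R t = 0" and "g = h"
      using x \<open>\<beta> \<noteq> 0\<close> by auto
    then have v: "v = - u"
      by (simp add: add_eq_0_iff)
    then have "2 *\<^sub>R u = 2 *\<^sub>R t"
      using uvt by (simp add: scaleR_2)
    then show ?thesis
      using v \<open>g = h\<close> by (simp add: w)
  qed
  have "nearest_points \<beta> (bilinear_graph \<alpha>) (z, - z, \<gamma>) = {(t, - t, h)}" (is "?N = _")
  proof (intro equalityI subsetI)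
    fix w assume "w \<in> ?N"
    then have "w \<in> bilinear_graph \<alpha>"
      and "weighted_norm \<beta> ((z, - z, \<gamma>) - w) \<le> d"
      using graph unfolding nearest_points_def d_def by blast+
    then have "sqrt (d\<^sup>2 + E w) \<le> sqrt (d\<^sup>2)"
      using dist \<open>d \<ge> 0\<close> by simp
    then have "E w \<le> 0"
      unfolding real_sqrt_le_iff by simp
    then show "w \<in> {(t, - t, h)}"
      using E_zero by simp
  next
    fix w assume "w \<in> {(t, - t, h)}"
    then have w: "w = (t, - t, h)" by simp
    have "weighted_norm \<beta> ((z, - z, \<gamma>) - w) \<le> weighted_norm \<beta> ((z, - z, \<gamma>) - w')"
      if "w' \<in> bilinear_graph \<alpha>" for w'
      unfolding dist[OF that] w d_def[symmetric]
      by (intro real_le_rsqrt) (simp add: E_nonneg)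
    then show "w \<in> ?N"
      using graph unfolding nearest_points_def w by blast
  qed
  then show ?thesis
    by (simp add: t_def h_def)
qed

section \<open>The cubic equation for the multiplier\<close>

text \<open>
  On \<open>x \<le> -1\<close> the function \<open>x + k + c / (1 - x)\<^sup>2\<close> is at most \<open>k - 1 + c / 4\<close>, because \<open>(1 - x)\<^sup>2\<close>
  is at least \<open>4\<close>.
\<close>
lemma multiplier_gt_minus_one:
  fixes x k c :: real
  assumes root: "(x + k) * (1 - x)\<^sup>2 + c = 0" and "c > 0" and "k - 1 < - (c / 4)"
  shows "-1 < x"
proof (rule ccontr)
  assume "\<not> -1 < x"
  then have "2\<^sup>2 \<le> (1 - x)\<^sup>2"
    by (intro power_mono) auto
  have "x + k < - (c / 4)"
    using \<open>\<not> -1 < x\<close> assms(3) by linarith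
  then have "(x + k) * (1 - x)\<^sup>2 < - (c / 4) * (1 - x)\<^sup>2"
    using \<open>\<not> -1 < x\<close> by (intro mult_strict_right_mono) auto
  also have "\<dots> \<le> - (c / 4) * 4"
    using \<open>2\<^sup>2 \<le> (1 - x)\<^sup>2\<close> \<open>c > 0\<close> by (intro mult_left_mono_neg) auto
  finally show False
    using root by simp
qed

lemma depress_multiplier_cubic:
  fixes m c k x y :: real
  assumes "k = 3 * m - 1" and "x = 1 - m + y"
  shows "(x + k) * (1 - x)\<^sup>2 + c = y ^ 3 + (- 3 * m\<^sup>2) * y + (2 * m ^ 3 + c)"
  unfolding assms by (simp add: algebra_simps power2_eq_square power3_eq_cube)

lemma cardano_root:
  fixes p q D :: real
  assumes D: "D = (p / 3) ^ 3 + (q / 2)\<^sup>2" and "D \<ge> 0"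
  defines "u \<equiv> root 3 (- q / 2 + sqrt D)" and "v \<equiv> root 3 (- q / 2 - sqrt D)"
  shows "u * v = - p / 3" and "(u + v) ^ 3 + p * (u + v) + q = 0"
proof -
  have "(- q / 2 + sqrt D) * (- q / 2 - sqrt D) = (q / 2)\<^sup>2 - (sqrt D)\<^sup>2"
    by (simp add: algebra_simps power2_eq_square)
  also have "\<dots> = (- p / 3) ^ 3"
    using \<open>D \<ge> 0\<close> D by (simp add: power_divide)
  finally have "u * v = root 3 ((- p / 3) ^ 3)"
    by (simp only: u_def v_def real_root_mult[symmetric])
  then show uv: "u * v = - p / 3"
    by (metis odd_real_root_power_cancel odd_numeral)
  have "u ^ 3 = - q / 2 + sqrt D" "v ^ 3 = - q / 2 - sqrt D"
    unfolding u_def v_def by (rule odd_real_root_pow; simp)+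
  then have "u ^ 3 + v ^ 3 = - q"
    by simp
  moreover have "(u + v) ^ 3 = u ^ 3 + v ^ 3 + 3 * (u * v) * (u + v)"
    by (simp add: algebra_simps power3_eq_cube)
  ultimately show "(u + v) ^ 3 + p * (u + v) + q = 0"
    unfolding uv by simp
qed

text \<open>
  Since \<open>sqrt D \<le> q / 2\<close> and \<open>q > 0\<close>, both \<open>u \<le> 0\<close> and \<open>v < 0\<close> hold, which suffices if \<open>m \<ge> 0\<close>. If \<open>m < 0\<close>,
  the inequality of arithmetic and geometric means together with \<open>u * v = m\<^sup>2\<close> gives
  \<open>u + v \<le> 2 * m < m\<close>.
\<close>
lemma cardano_root_less:
  fixes m c p q D :: real
  assumes p: "p = - 3 * m\<^sup>2" and q: "q = 2 * m ^ 3 + c" and "c > 0"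
    and D: "D = (p / 3) ^ 3 + (q / 2)\<^sup>2" and "D \<ge> 0"
  defines "u \<equiv> root 3 (- q / 2 + sqrt D)" and "v \<equiv> root 3 (- q / 2 - sqrt D)"
  shows "u + v < m"
proof -
  have "D = c * (m ^ 3 + c / 4)"
    unfolding D p q by (simp add: algebra_simps power2_eq_square power3_eq_cube)
  then have "m ^ 3 + c / 4 \<ge> 0"
    using \<open>D \<ge> 0\<close> \<open>c > 0\<close> by (simp add: zero_le_mult_iff)
  then have "q > 0"
    using q \<open>c > 0\<close> by simp
  have "(p / 3) ^ 3 = - ((m ^ 3)\<^sup>2)"
    unfolding p by (simp add: power2_eq_square power3_eq_cube)
  then have "D \<le> (q / 2)\<^sup>2"
    using D by simp
  then have "sqrt D \<le> q / 2"
    using \<open>q > 0\<close> by (intro real_le_lsqrt) auto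
  moreover have "sqrt D \<ge> 0"
    using \<open>D \<ge> 0\<close> by simp
  ultimately have "- q / 2 + sqrt D \<le> 0" and "- q / 2 - sqrt D < 0"
    using \<open>q > 0\<close> by linarith+
  then have "u \<le> 0" and "v < 0"
    unfolding u_def v_def by (simp_all only: real_root_le_0_iff real_root_lt_0_iff zero_less_numeral)
  then have "u + v < 0"
    by simp
  moreover have "u * v = m\<^sup>2"
    using cardano_root(1)[OF D \<open>D \<ge> 0\<close>] p by (simp add: u_def v_def)
  ultimately show ?thesis
  proof (cases "m < 0")
    case True
    have "4 * (u * v) \<le> (u + v)\<^sup>2"
      using zero_le_power2[of "u - v"] by (simp add: algebra_simps power2_eq_square)
    moreover have "0 < m\<^sup>2"
      using True by simp
    ultimately have "m\<^sup>2 < (u + v)\<^sup>2"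
      using \<open>u * v = m\<^sup>2\<close> by linarith
    then have "\<bar>m\<bar> < \<bar>u + v\<bar>"
      using abs_le_square_iff[of "u + v" m] by linarith
    then show ?thesis
      using True \<open>u + v < 0\<close> by linarith
  qed simp
qed

text \<open>
  Scaling \<open>y = - 2 * m * cos \<phi>\<close> turns the cubic into the triple angle formula for
  \<open>cos (3 * \<phi>)\<close>. Adding \<open>2 * pi\<close> to the angle \<open>arccos (1 + c / (2 * m\<^sup>3))\<close> before dividing it
  by \<open>3\<close> places \<open>\<phi>\<close> strictly between \<open>2 * pi / 3\<close> and \<open>pi\<close>; of the three real roots, this selects
  the smallest one, which is the one below \<open>m\<close>.
\<close>
lemma viete_root_less:
  fixes m c y :: real
  assumes "c > 0" and neg: "m ^ 3 + c / 4 < 0"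
    and y: "y = - 2 * m * cos (1 / 3 * (2 * pi + arccos (1 + c / (2 * m ^ 3))))"
  shows "y ^ 3 + (- 3 * m\<^sup>2) * y + (2 * m ^ 3 + c) = 0" and "y < m"
proof -
  define r where "r = 1 + c / (2 * m ^ 3)"
  define \<phi> where "\<phi> = 1 / 3 * (2 * pi + arccos r)"
  have m3: "m ^ 3 < 0"
    using neg \<open>c > 0\<close> by linarith
  then have "m < 0"
    by (simp add: power_less_zero_eq)
  have r: "-1 < r" "r < 1"
    using neg m3 \<open>c > 0\<close> by (auto simp: r_def field_simps)
  have y\<phi>: "y = - 2 * m * cos \<phi>"
    unfolding y \<phi>_def r_def ..
  have "cos (3 * \<phi>) = cos (arccos r + 2 * pi)"
    by (simp add: \<phi>_def algebra_simps)
  also have "\<dots> = r"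
    using r by simp
  finally have cubic: "4 * cos \<phi> ^ 3 - 3 * cos \<phi> = r"
    by (simp add: cos_treble_cos)
  have "y ^ 3 + (- 3 * m\<^sup>2) * y = - 2 * m ^ 3 * (4 * cos \<phi> ^ 3 - 3 * cos \<phi>)"
    unfolding y\<phi> by (simp add: algebra_simps power2_eq_square power3_eq_cube)
  also have "\<dots> = - (2 * m ^ 3 + c)"
    unfolding cubic r_def using m3 by (simp add: field_simps)
  finally show "y ^ 3 + (- 3 * m\<^sup>2) * y + (2 * m ^ 3 + c) = 0"
    by simp
  have "0 < arccos r" "arccos r < pi"
    using arccos_lt_bounded[of r] r by auto
  then have "2 * pi / 3 < \<phi>" "\<phi> < pi"
    by (auto simp: \<phi>_def)
  then have "cos \<phi> < cos (2 * pi / 3)"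
    by (intro cos_monotone_0_pi) auto
  then have "cos \<phi> < - 1 / 2"
    by (simp add: cos_120)
  then have "- 2 * m * cos \<phi> < - 2 * m * (- 1 / 2)"
    using \<open>m < 0\<close> by (intro mult_strict_left_mono) auto
  then show "y < m"
    unfolding y\<phi> by simp
qed

section \<open>The projection in closed form\<close>

theorem theorem7p1:
  fixes z :: "'a :: {real_inner, complete_space}"
    and \<alpha> \<beta> \<gamma> \<zeta> p q \<Delta> \<delta> x :: real
  assumes "\<alpha> \<noteq> 0" and "\<beta> > 0"
    and "z \<noteq> 0"
    and "\<zeta> = norm z"
    and "\<alpha> * (\<gamma> - \<alpha> / \<beta>\<^sup>2) < - (\<zeta>\<^sup>2 / 4)"
    and "p = - ((\<alpha> + \<beta>\<^sup>2 * \<gamma>)\<^sup>2 / (3 * \<alpha>\<^sup>2))"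
    and "q = 2 * (\<alpha> + \<beta>\<^sup>2 * \<gamma>) ^ 3 / (27 * \<alpha> ^ 3) + \<beta>\<^sup>2 * \<zeta>\<^sup>2 / \<alpha>\<^sup>2"
    and "\<Delta> = (p / 3) ^ 3 + (q / 2)\<^sup>2"
    and "\<delta> = sgn (\<alpha>\<^sup>2 + \<alpha> * \<beta>\<^sup>2 * \<gamma>)"
    and "x = (if \<Delta> \<ge> 0
              then (2 * \<alpha> - \<beta>\<^sup>2 * \<gamma>) / (3 * \<alpha>)
                   + root 3 (- q / 2 + sqrt \<Delta>) + root 3 (- q / 2 - sqrt \<Delta>)
              else (2 * \<alpha> - \<beta>\<^sup>2 * \<gamma>) / (3 * \<alpha>)
                   + \<delta> * (2 * (\<alpha> + \<beta>\<^sup>2 * \<gamma>) / (3 * \<alpha>))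
                       * cos (1 / 3 * ((3 + \<delta>) * pi + arccos ((- q / 2) / (- p / 3) powr (3 / 2)))))"
  shows "\<Delta> = \<beta>\<^sup>2 * \<zeta>\<^sup>2 / \<alpha>\<^sup>2 *
             (\<beta>\<^sup>2 * \<zeta>\<^sup>2 / (4 * \<alpha>\<^sup>2) + (\<alpha> + \<beta>\<^sup>2 * \<gamma>) ^ 3 / (27 * \<alpha> ^ 3))
         \<and> - 1 < x \<and> x < 1
         \<and> nearest_points \<beta> (bilinear_graph \<alpha>) (z, - z, \<gamma>)
             = {((1 / (1 - x)) *\<^sub>R z, (1 / (1 - x)) *\<^sub>R (- z), \<gamma> + \<alpha> * x / \<beta>\<^sup>2)}"
proof -
  define k where "k = \<beta>\<^sup>2 * \<gamma> / \<alpha>"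
  define c where "c = \<beta>\<^sup>2 * \<zeta>\<^sup>2 / \<alpha>\<^sup>2"
  define m where "m = (1 + k) / 3"
  define y where "y = x - (1 - m)"
  have k: "k = 3 * m - 1" and x: "x = 1 - m + y"
    by (simp_all add: m_def y_def field_simps)
  have "\<zeta> > 0"
    using assms(3,4) by simp
  then have "c > 0"
    using assms(1,2) by (simp add: c_def)
  have m: "(\<alpha> + \<beta>\<^sup>2 * \<gamma>) / (3 * \<alpha>) = m"
    using assms(1) by (simp add: m_def k_def field_simps)
  then have sum: "\<alpha> + \<beta>\<^sup>2 * \<gamma> = 3 * \<alpha> * m"
    using assms(1) by (simp add: field_simps)
  have p: "p = - 3 * m\<^sup>2"
    unfolding assms(6) sum using assms(1) by (simp add: field_simps power2_eq_square)
  have q: "q = 2 * m ^ 3 + c"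
    unfolding assms(7) sum c_def using assms(1) by (simp add: power_mult_distrib)
  have shift: "(2 * \<alpha> - \<beta>\<^sup>2 * \<gamma>) / (3 * \<alpha>) = 1 - m"
    using assms(1) by (simp add: m_def k_def field_simps)
  have D: "\<Delta> = c * (c / 4 + m ^ 3)"
    unfolding assms(8) p q by (simp add: algebra_simps power2_eq_square power3_eq_cube)
  have y_root: "y ^ 3 + (- 3 * m\<^sup>2) * y + (2 * m ^ 3 + c) = 0 \<and> y < m"
  proof (cases "\<Delta> \<ge> 0")
    case True
    then have y: "y = root 3 (- q / 2 + sqrt \<Delta>) + root 3 (- q / 2 - sqrt \<Delta>)"
      unfolding y_def assms(10) shift by simp
    show ?thesis
      using cardano_root(2)[OF assms(8) True] cardano_root_less[OF p q \<open>c > 0\<close> assms(8) True]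
      unfolding y p q by simp
  next
    case False
    then have neg: "m ^ 3 + c / 4 < 0"
      using \<open>c > 0\<close> by (simp add: D not_le mult_less_0_iff add.commute)
    then have "m ^ 3 < 0"
      using \<open>c > 0\<close> by linarith
    then have "m < 0"
      by (simp add: power_less_zero_eq)
    have "\<alpha>\<^sup>2 + \<alpha> * \<beta>\<^sup>2 * \<gamma> = \<alpha> * (\<alpha> + \<beta>\<^sup>2 * \<gamma>)"
      by (simp add: algebra_simps power2_eq_square)
    also have "\<dots> = 3 * \<alpha>\<^sup>2 * m"
      unfolding sum by (simp add: power2_eq_square)
    also have "\<dots> < 0"
      using \<open>m < 0\<close> assms(1) by (simp add: mult_pos_neg)
    finally have \<delta>: "\<delta> = - 1"
      using assms(9) by simp
    have "- p / 3 = (- m) powr 2"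
      using \<open>m < 0\<close> p by simp
    then have "(- p / 3) powr (3 / 2) = (- m) powr 3"
      by (simp only: powr_powr) simp
    also have "\<dots> = - (m ^ 3)"
      using \<open>m < 0\<close> by simp
    finally have "(- q / 2) / (- p / 3) powr (3 / 2) = 1 + c / (2 * m ^ 3)"
      using \<open>m ^ 3 < 0\<close> q by (simp add: field_simps)
    moreover have "2 * (\<alpha> + \<beta>\<^sup>2 * \<gamma>) / (3 * \<alpha>) = 2 * m"
      unfolding sum using assms(1) by simp
    ultimately have "y = - 2 * m * cos (1 / 3 * (2 * pi + arccos (1 + c / (2 * m ^ 3))))"
      unfolding y_def assms(10) shift \<delta> using False by simp
    with viete_root_less[OF \<open>c > 0\<close> neg] show ?thesis
      by blast
  qed
  then have root: "(x + k) * (1 - x)\<^sup>2 + c = 0" and x1: "x < 1"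
    using depress_multiplier_cubic[OF k x, of c] x by auto
  \<comment> \<open>This is the hypothesis on \<open>\<gamma>\<close>, multiplied by \<open>\<beta>\<^sup>2 / \<alpha>\<^sup>2\<close>.\<close>
  have "\<beta>\<^sup>2 / \<alpha>\<^sup>2 * (\<alpha> * (\<gamma> - \<alpha> / \<beta>\<^sup>2)) < \<beta>\<^sup>2 / \<alpha>\<^sup>2 * - (\<zeta>\<^sup>2 / 4)"
    using assms(1,2,5) by (intro mult_strict_left_mono) auto
  moreover have "\<beta>\<^sup>2 / \<alpha>\<^sup>2 * (\<alpha> * (\<gamma> - \<alpha> / \<beta>\<^sup>2)) = k - 1"
    using assms(1,2) by (simp add: k_def field_simps power2_eq_square)
  ultimately have "k - 1 < - (c / 4)"
    by (simp add: c_def)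
  then have x0: "-1 < x"
    using multiplier_gt_minus_one root \<open>c > 0\<close> by blast
  have "\<alpha> * (\<gamma> + \<alpha> * x / \<beta>\<^sup>2) = \<alpha>\<^sup>2 / \<beta>\<^sup>2 * (x + k)"
    using assms(1,2) by (simp add: k_def field_simps power2_eq_square)
  also have "x + k = - (c / (1 - x)\<^sup>2)"
    using root x1 by (simp add: field_simps)
  also have "\<alpha>\<^sup>2 / \<beta>\<^sup>2 * - (c / (1 - x)\<^sup>2) = - ((norm z)\<^sup>2 / (1 - x)\<^sup>2)"
    using assms(1,2,4) by (simp add: c_def)
  finally have mult: "\<alpha> * (\<gamma> + \<alpha> * x / \<beta>\<^sup>2) + (norm z)\<^sup>2 / (1 - x)\<^sup>2 = 0"
    by simp
  have "\<Delta> = \<beta>\<^sup>2 * \<zeta>\<^sup>2 / \<alpha>\<^sup>2 *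
      (\<beta>\<^sup>2 * \<zeta>\<^sup>2 / (4 * \<alpha>\<^sup>2) + (\<alpha> + \<beta>\<^sup>2 * \<gamma>) ^ 3 / (27 * \<alpha> ^ 3))"
    unfolding D sum c_def using assms(1) by (simp add: power_mult_distrib)
  moreover have "\<beta> \<noteq> 0"
    using assms(2) by simp
  ultimately show ?thesis
    using x0 x1 nearest_points_bilinear_graph_antidiagonal[OF _ x0 x1 mult] by blast
qed

end
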